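(* Let $K$ be a non-Archimedean local field and let $\varphi\in L^1_{\mathrm{loc}}(K)$ be a radial function with Laplace type transform $$ \widetilde{\varphi}(|\xi|_K)=\int\limits_K v_0(|x\xi|_K)\varphi(|x|_K)\,dx . $$ If $\widetilde{\varphi}(|\xi|_K)\equiv 0$, then $\varphi(|x|_K)\equiv\mathrm{const}$.
   Context: $K$ is a non-Archimedean local field (a non-discrete totally disconnected locally compact topological field) with absolute value $|\cdot|_K$, $q$ is the cardinality of its residue field, and the absolute value is normalized so that its nonzero values are exactly $q^N$, $N\in\mathbb Z$. $dx$ is the Haar measure on the additive group of $K$ normalized so that the unit ball $\{|x|_K\le1\}$ has measure $1$. A radial function is a complex-valued function $\varphi=\varphi(|x|_K)$ depending only on $|x|_K$; it is identified with a function on the set $q^{\mathbb Z}=\{q^n:n\in\mathbb Z\}$. The function $v_0$ is $$ v_0(|x|_K)=\begin{cases}1,&|x|_K\le1,\\ -\frac1{q-1},&|x|_K=q,\\ 0,&|x|_K\ge q^2.\end{cases} $$ The transform $\widetilde\varphi$ is considered for $\xi\in K$ with $|\xi|_K=q^N$, $N\in\mathbb Z$, so that $\widetilde\varphi$ is a function on $q^{\mathbb Z}$. *)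

theory Defs
  imports "HOL-Analysis.Analysis"
begin

class topological_field = field + topological_ab_group_add + topological_semigroup_mult +
  assumes tendsto_inverse_nhds: "a \<noteq> 0 \<Longrightarrow> filterlim inverse (nhds (inverse a)) (nhds a)"

class nonarch_local_field = topological_field +
  assumes not_discrete: "\<not> (\<forall>S. open S)"
    and totally_disconnected: "connected S \<Longrightarrow> \<exists>x. S \<subseteq> {x}"
    and locally_compact: "\<exists>U C. open U \<and> compact C \<and> x \<in> U \<and> U \<subseteq> C"

(* The residue field is O/P with O = {x. |x| \<le> 1} and P = {x. |x| < 1};
   its elements are the classes of O modulo P. *)
definition residue_card :: "('a::field \<Rightarrow> real) \<Rightarrow> nat" where
  "residue_card absK =
     card ({x. absK x \<le> 1} // {(x, y). absK x \<le> 1 \<and> absK y \<le> 1 \<and> absK (x - y) < 1})"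

(* If the residue field were infinite, residue_card would be 0, and the last conjunct
   could not hold, so finiteness of the residue field is not lost. *)
definition normalized_absolute_value :: "('a::nonarch_local_field \<Rightarrow> real) \<Rightarrow> bool" where
  "normalized_absolute_value absK \<longleftrightarrow>
     (\<forall>x. absK x \<ge> 0) \<and>
     (\<forall>x. absK x = 0 \<longleftrightarrow> x = 0) \<and>
     (\<forall>x y. absK (x * y) = absK x * absK y) \<and>
     (\<forall>x y. absK (x + y) \<le> max (absK x) (absK y)) \<and>
     (\<forall>U. open U \<longleftrightarrow> (\<forall>x\<in>U. \<exists>e>0. \<forall>y. absK (y - x) < e \<longrightarrow> y \<in> U)) \<and>
     absK ` (- {0}) = range (\<lambda>N::int. real (residue_card absK) powi N)"

(* Nonzero translation-invariant Radon measure on the Borel sets. *)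
definition haar_measure :: "'a::topological_ab_group_add measure \<Rightarrow> bool" where
  "haar_measure \<mu> \<longleftrightarrow>
     sets \<mu> = sets borel \<and>
     emeasure \<mu> UNIV \<noteq> 0 \<and>
     (\<forall>a. \<forall>A\<in>sets borel. emeasure \<mu> ((+) a ` A) = emeasure \<mu> A) \<and>
     (\<forall>C. compact C \<longrightarrow> emeasure \<mu> C < \<infinity>) \<and>
     (\<forall>A\<in>sets borel. emeasure \<mu> A = (INF U\<in>{U. open U \<and> A \<subseteq> U}. emeasure \<mu> U)) \<and>
     (\<forall>U. open U \<longrightarrow> emeasure \<mu> U = (SUP C\<in>{C. compact C \<and> C \<subseteq> U}. emeasure \<mu> C))"

definition locally_integrable :: "'a::topological_space measure \<Rightarrow> ('a \<Rightarrow> complex) \<Rightarrow> bool" where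
  "locally_integrable \<mu> f \<longleftrightarrow> (\<forall>C. compact C \<longrightarrow> set_integrable \<mu> C f)"

(* Only evaluated at t = 0 and at integer powers of q, where the last case means t \<ge> q^2. *)
definition v0 :: "nat \<Rightarrow> real \<Rightarrow> real" where
  "v0 q t = (if t \<le> 1 then 1 else if t = real q then - 1 / (real q - 1) else 0)"

(* A radial function is given by its profile \<phi> on the set of values of |.|.
   The transform depends on \<xi> only through |\<xi>|; it is considered for \<xi> \<noteq> 0. *)
definition laplace_type_transform ::
  "('a::field \<Rightarrow> real) \<Rightarrow> 'a measure \<Rightarrow> (real \<Rightarrow> complex) \<Rightarrow> 'a \<Rightarrow> complex" where
  "laplace_type_transform absK \<mu> \<phi> \<xi> =
     (LINT x|\<mu>. complex_of_real (v0 (residue_card absK) (absK (x * \<xi>))) * \<phi> (absK x))"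

end

theory Submission
  imports Defs
begin

text \<open>
  Write \<open>B r\<close> for the closed ball of radius \<open>r\<close> and \<open>I r\<close> for the integral of \<open>\<phi>\<close> over it. At
  \<open>\<bar>\<xi>\<bar> = 1 / r\<close> the transform equals \<open>I r - \<mu> (S (q r)) \<phi> (q r) / (q - 1)\<close>, where the sphere
  \<open>S (q r) = B (q r) - B r\<close> has measure \<open>(q - 1) \<mu> (B r)\<close> because \<open>B (q r)\<close> consists of \<open>q\<close> cosets
  of \<open>B r\<close>. So a vanishing transform means \<open>I r = \<mu> (B r) \<phi> (q r)\<close>. Then
  \<open>I (q r) = I r + \<mu> (S (q r)) \<phi> (q r) = q I r\<close>, and comparing the formulas for \<open>I r\<close> and \<open>I (q r)\<close>
  gives \<open>\<phi> (q\<^sup>2 r) = \<phi> (q r)\<close>.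
\<close>

section \<open>The absolute value and its value group\<close>

locale normalized_local_field =
  fixes absK :: "'a::nonarch_local_field \<Rightarrow> real"
  assumes normalized: "normalized_absolute_value absK"
begin

abbreviation q :: real where "q \<equiv> real (residue_card absK)"

definition closed_ball :: "real \<Rightarrow> 'a set" where
  "closed_ball r = {x. absK x \<le> r}"

text \<open>Congruence modulo the maximal ideal, the relation written inline in
  \<open>residue_card\<close>.\<close>

definition residue_rel :: "('a \<times> 'a) set" where
  "residue_rel = {(x, y). absK x \<le> 1 \<and> absK y \<le> 1 \<and> absK (x - y) < 1}"

lemmas normalized_conjs = normalized[unfolded normalized_absolute_value_def]

lemma absK_nonneg [simp]: "absK x \<ge> 0"
  using normalized_conjs[THEN conjunct1] by simp

lemma absK_eq_0_iff [simp]: "absK x = 0 \<longleftrightarrow> x = 0"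
  using normalized_conjs[THEN conjunct2, THEN conjunct1] by simp

lemma absK_mult: "absK (x * y) = absK x * absK y"
  using normalized_conjs[THEN conjunct2, THEN conjunct2, THEN conjunct1] by simp

lemma absK_add_le: "absK (x + y) \<le> max (absK x) (absK y)"
  using normalized_conjs[THEN conjunct2, THEN conjunct2, THEN conjunct2, THEN conjunct1] by simp

lemma open_iff: "open U \<longleftrightarrow> (\<forall>x\<in>U. \<exists>e>0. \<forall>y. absK (y - x) < e \<longrightarrow> y \<in> U)"
  by (rule normalized_conjs[THEN conjunct2, THEN conjunct2, THEN conjunct2, THEN conjunct2,
        THEN conjunct1, THEN spec])

lemma absK_range: "absK ` (- {0}) = range (\<lambda>N::int. q powi N)"
  by (intro normalized_conjs[THEN conjunct2, THEN conjunct2, THEN conjunct2, THEN conjunct2,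
        THEN conjunct2])

lemma absK_pos [simp]: "absK x > 0 \<longleftrightarrow> x \<noteq> 0"
  using absK_nonneg[of x] absK_eq_0_iff[of x] by linarith

lemma absK_0 [simp]: "absK 0 = 0"
  by simp

lemma absK_1 [simp]: "absK 1 = 1"
  using absK_mult[of 1 1] absK_eq_0_iff[of 1] by simp

lemma absK_minus [simp]: "absK (- x) = absK x"
proof -
  have "absK (- 1) * absK (- 1) = 1"
    using absK_mult[of "- 1" "- 1"] by simp
  then have "absK (- 1) = 1"
    using absK_nonneg[of "- 1"] by (metis abs_of_nonneg abs_1 abs_mult_self_eq real_sqrt_abs2 real_sqrt_one)
  then show ?thesis
    using absK_mult[of "- 1" x] by simp
qed

lemma absK_diff_le: "absK (x - y) \<le> max (absK x) (absK y)"
  using absK_add_le[of x "- y"] by simp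

lemma absK_minus_commute: "absK (x - y) = absK (y - x)"
  using absK_minus[of "x - y"] by simp

lemma absK_divide: "y \<noteq> 0 \<Longrightarrow> absK (x / y) = absK x / absK y"
  using absK_mult[of "x / y" y] by (simp add: field_simps)

lemma absK_values: "x \<noteq> 0 \<Longrightarrow> \<exists>N::int. absK x = q powi N"
  using absK_range by (metis ComplI imageI imageE singletonD)

lemma absK_attains: "\<exists>x. x \<noteq> 0 \<and> absK x = q powi N"
proof -
  have "q powi N \<in> absK ` (- {0})" using absK_range by auto
  then show ?thesis by auto
qed

text \<open>Cardinality 0 (also the value of \<open>card\<close> on an infinite residue field) would
  give a nonzero element of absolute value \<open>0 powi 1 = 0\<close>. Cardinality 1 would make
  every nonzero absolute value 1, so open balls of radius 1 would be singletons and the topology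
  discrete.\<close>

lemma q_gt_1: "q > 1"
proof (rule ccontr)
  assume "\<not> q > 1"
  then consider "residue_card absK = 0" | "residue_card absK = 1" by linarith
  then show False
  proof cases
    case 1
    then show ?thesis using absK_attains[of 1] by auto
  next
    case 2
    then have "absK x = 1" if "x \<noteq> 0" for x
      using absK_values[OF that] by auto
    then have "y = x" if "absK (y - x) < 1" for x y
      using that by (metis order_less_irrefl right_minus_eq)
    then have "open S" for S :: "'a set"
      unfolding open_iff by (metis zero_less_one)
    then show ?thesis using not_discrete by blast
  qed
qed

text \<open>Nonzero values are integer powers of \<open>q > 1\<close>, so a strict inequality
  between two of them raises the exponent by at least 1.\<close>

lemma value_gap:
  assumes "x \<noteq> 0" "absK x < absK y"
  shows "q * absK x \<le> absK y"
proof -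
  have y: "y \<noteq> 0" using assms(2) absK_nonneg[of x] by (metis absK_0 not_less)
  obtain m where m: "absK x = q powi m" using absK_values[OF assms(1)] by blast
  obtain n where n: "absK y = q powi n" using absK_values[OF y] by blast
  have "m < n"
  proof (rule ccontr)
    assume "\<not> m < n"
    then have "q powi n \<le> q powi m" using q_gt_1 by (intro power_int_increasing) auto
    then show False using assms(2) m n by simp
  qed
  then have "q powi (m + 1) \<le> q powi n" using q_gt_1 by (intro power_int_increasing) auto
  then show ?thesis using m n q_gt_1 by (simp add: power_int_add_1 mult.commute)
qed

section \<open>Topology of balls\<close>

lemma open_open_ball: "open {y. absK (y - x) < r}"
proof -
  have "absK (z - x) < r" if "absK (y - x) < r" "absK (z - y) < r" for y z
    using absK_add_le[of "z - y" "y - x"] that by simp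
  moreover have "r > 0" if "absK (y - x) < r" for y
    using absK_nonneg[of "y - x"] that by linarith
  ultimately show ?thesis
    unfolding open_iff by blast
qed

lemma open_closed_ball:
  assumes "r > 0"
  shows "open (closed_ball r)"
proof -
  have "absK y \<le> r" if "absK x \<le> r" "absK (y - x) < r" for x y
    using absK_add_le[of "y - x" x] that by simp
  then show ?thesis
    unfolding open_iff closed_ball_def using assms by blast
qed

lemma closed_closed_ball:
  assumes "r > 0"
  shows "closed (closed_ball r)"
proof -
  \<comment> \<open>Contrapositively, an open ball of radius \<open>r\<close> around a point outside
    the closed ball stays outside it.\<close>
  have "absK x \<le> r" if "absK y \<le> r" "absK (y - x) < r" for x y
    using absK_diff_le[of y "y - x"] that by simp
  then show ?thesis
    unfolding closed_def open_iff closed_ball_def using assms by blast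
qed

lemma closed_ball_scale:
  assumes "a \<noteq> 0"
  shows "(*) a ` closed_ball r = closed_ball (absK a * r)"
proof (intro equalityI subsetI)
  fix y assume "y \<in> closed_ball (absK a * r)"
  then have "y / a \<in> closed_ball r" "y = a * (y / a)"
    using assms by (simp_all add: closed_ball_def absK_divide field_simps)
  then show "y \<in> (*) a ` closed_ball r" by blast
qed (use assms in \<open>auto simp: closed_ball_def absK_mult\<close>)

text \<open>Local compactness at 0 puts some small ball inside a compact set, and that ball is
  compact because it is closed. Multiplication by \<open>a / b\<close> is continuous and maps it
  onto the ball of radius \<open>absK a\<close>.\<close>

lemma compact_closed_ball:
  assumes "a \<noteq> 0"
  shows "compact (closed_ball (absK a))"
proof -
  obtain U C where UC: "open U" "compact C" "0 \<in> U" "U \<subseteq> (C :: 'a set)"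
    using locally_compact[of 0] by blast
  then obtain e where e: "e > 0" "\<And>y. absK y < e \<Longrightarrow> y \<in> U"
    unfolding open_iff by (metis diff_zero)
  \<comment> \<open>Values tend to 0 along negative powers of \<open>q\<close>, so some value
    \<open>q powi (- int n)\<close> is below the radius \<open>e\<close> given by openness of
    \<open>U\<close>.\<close>
  obtain n :: nat where n: "(1 / q) ^ n < e"
    using real_arch_pow_inv[OF e(1), of "1 / q"] q_gt_1 by auto
  obtain b where b: "b \<noteq> 0" "absK b = q powi (- int n)" using absK_attains by blast
  have "absK b < e" using n b(2) by (simp add: power_int_minus power_one_over inverse_eq_divide)
  then have "closed_ball (absK b) \<subseteq> C"
    using e(2) UC(4) by (fastforce simp: closed_ball_def)
  then have "compact (closed_ball (absK b))"
    using compact_Int_closed[OF UC(2) closed_closed_ball[of "absK b"]] b(1)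
    by (simp add: Int_absorb1)
  moreover have "continuous_on UNIV ((*) (a / b))"
    unfolding continuous_on_def by (intro ballI tendsto_mult tendsto_const tendsto_ident_at)
  ultimately have "compact ((*) (a / b) ` closed_ball (absK b))"
    by (meson compact_continuous_image continuous_on_subset subset_UNIV)
  then show ?thesis
    using closed_ball_scale[of "a / b" "absK b"] assms b(1) by (simp add: absK_divide)
qed

section \<open>Residue classes and their scaled copies\<close>

lemma equiv_residue_rel: "equiv (closed_ball 1) residue_rel"
proof (rule equivI)
  show "residue_rel \<subseteq> closed_ball 1 \<times> closed_ball 1"
    and "refl_on (closed_ball 1) residue_rel"
    by (auto simp: residue_rel_def closed_ball_def refl_on_def)
  show "sym residue_rel"
    by (auto simp: residue_rel_def sym_def absK_minus_commute)
  have "absK (x - z) < 1" if "absK (x - y) < 1" "absK (y - z) < 1" for x y z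
    using absK_add_le[of "x - y" "y - z"] that by simp
  then show "trans residue_rel"
    unfolding residue_rel_def trans_def by blast
qed

lemma card_residue_classes: "card (closed_ball 1 // residue_rel) = residue_card absK"
  by (simp add: residue_card_def residue_rel_def closed_ball_def)

lemma finite_residue_classes: "finite (closed_ball 1 // residue_rel)"
  using card_residue_classes q_gt_1 by (intro card_ge_0_finite) simp

text \<open>Presents the scaled residue classes as open balls of a common radius, hence as
  translates of one another, so that translation invariance of the Haar measure can compare
  them.\<close>

lemma residue_class_scale:
  assumes "a \<noteq> 0" "x \<in> closed_ball 1"
  shows "(*) a ` (residue_rel `` {x}) = {y. absK (y - a * x) < absK a}"
proof (intro equalityI subsetI)
  fix y assume "y \<in> (*) a ` (residue_rel `` {x})"
  then obtain z where z: "y = a * z" "absK (x - z) < 1"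
    by (auto simp: residue_rel_def)
  have "absK (y - a * x) = absK a * absK (x - z)"
    by (simp add: z(1) absK_minus_commute[of x] flip: absK_mult right_diff_distrib)
  then show "y \<in> {y. absK (y - a * x) < absK a}"
    using assms(1) z(2) by simp
next
  fix y assume y: "y \<in> {y. absK (y - a * x) < absK a}"
  have "absK (y / a - x) = absK (y - a * x) / absK a"
    using assms(1) absK_divide[of a "y - a * x"] by (simp add: diff_divide_distrib)
  then have d: "absK (y / a - x) < 1"
    using y assms(1) by simp
  \<comment> \<open>\<open>residue_rel\<close> relates only points of the unit ball; a point at
    distance below 1 from \<open>x\<close> lies there by the ultrametric inequality.\<close>
  then have "absK (y / a) \<le> 1"
    using absK_add_le[of "y / a - x" x] assms(2) by (simp add: closed_ball_def)
  then have "y / a \<in> residue_rel `` {x}"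
    using d assms(2) by (simp add: residue_rel_def closed_ball_def absK_minus_commute[of x])
  moreover have "y = a * (y / a)" using assms(1) by simp
  ultimately show "y \<in> (*) a ` (residue_rel `` {x})" by blast
qed

text \<open>No value lies strictly between \<open>absK b\<close> and
  \<open>q * absK b\<close>.\<close>

lemma open_ball_eq_closed_ball:
  assumes "b \<noteq> 0" "absK a = q * absK b"
  shows "{y. absK y < absK a} = closed_ball (absK b)"
proof -
  have "absK b < absK a" using assms q_gt_1 by simp
  moreover have "absK y \<le> absK b" if "absK y < absK a" for y
    using value_gap[OF assms(1), of y] that assms(2) by linarith
  ultimately show ?thesis by (fastforce simp: closed_ball_def)
qed

section \<open>Haar measure of balls and spheres\<close>

context
  fixes \<mu> :: "'a measure"
  assumes haar: "haar_measure \<mu>"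
begin

lemma open_in_sets: "open U \<Longrightarrow> U \<in> sets \<mu>"
  using haar[unfolded haar_measure_def, THEN conjunct1] by simp

lemma emeasure_translate: "open U \<Longrightarrow> emeasure \<mu> ((+) b ` U) = emeasure \<mu> U"
  using haar[unfolded haar_measure_def, THEN conjunct2, THEN conjunct2, THEN conjunct1] by simp

lemma emeasure_compact_finite: "compact C \<Longrightarrow> emeasure \<mu> C < \<infinity>"
  using haar[unfolded haar_measure_def, THEN conjunct2, THEN conjunct2, THEN conjunct2,
      THEN conjunct1] by simp

lemma closed_ball_in_sets: "b \<noteq> 0 \<Longrightarrow> closed_ball (absK b) \<in> sets \<mu>"
  by (simp add: open_in_sets open_closed_ball)

lemma emeasure_closed_ball_finite: "b \<noteq> 0 \<Longrightarrow> emeasure \<mu> (closed_ball (absK b)) < \<infinity>"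
  by (intro emeasure_compact_finite compact_closed_ball)

lemma emeasure_open_ball: "emeasure \<mu> {y. absK (y - b) < r} = emeasure \<mu> {y. absK y < r}"
proof -
  have "y \<in> (+) b ` {y. absK y < r}" if "absK (y - b) < r" for y
    using that by (intro image_eqI[of _ _ "y - b"]) auto
  then have "{y. absK (y - b) < r} = (+) b ` {y. absK y < r}" by auto
  then show ?thesis
    using emeasure_translate[of "{y. absK y < r}" b] open_open_ball[of 0 r] by simp
qed

text \<open>The larger ball is \<open>a\<close> times the unit ball, hence the disjoint union of the
  scaled residue classes. Each of these is an open ball of radius \<open>absK a\<close>, that is, a
  translate of the smaller closed ball.\<close>

lemma emeasure_closed_ball_step:
  assumes "a \<noteq> 0" "b \<noteq> 0" "absK a = q * absK b"
  shows "emeasure \<mu> (closed_ball (absK a)) =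
    of_nat (residue_card absK) * emeasure \<mu> (closed_ball (absK b))"
proof -
  let ?Q = "closed_ball 1 // residue_rel"
  have coset: "\<exists>x. (*) a ` X = {y. absK (y - a * x) < absK a}" if "X \<in> ?Q" for X
    using that residue_class_scale[OF assms(1)] by (metis quotientE)
  have disj: "disjoint_family_on ((`) ((*) a)) ?Q"
  proof (unfold disjoint_family_on_def, intro ballI impI)
    fix X Y assume "X \<in> ?Q" "Y \<in> ?Q" "X \<noteq> Y"
    then have "X \<inter> Y = {}" using quotient_disj[OF equiv_residue_rel] by blast
    then show "(*) a ` X \<inter> (*) a ` Y = {}" using assms(1) by auto
  qed
  have "closed_ball (absK a) = (*) a ` closed_ball 1"
    using closed_ball_scale[OF assms(1), of 1] by simp
  also have "\<dots> = (\<Union>X\<in>?Q. (*) a ` X)"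
    using Union_quotient[OF equiv_residue_rel] by (metis image_Union)
  also have "emeasure \<mu> \<dots> = (\<Sum>X\<in>?Q. emeasure \<mu> ((*) a ` X))"
    using coset open_open_ball finite_residue_classes disj
    by (intro sum_emeasure[symmetric]) (force intro: open_in_sets)+
  also have "\<dots> = (\<Sum>X\<in>?Q. emeasure \<mu> (closed_ball (absK b)))"
    using coset emeasure_open_ball open_ball_eq_closed_ball[OF assms(2,3)]
    by (intro sum.cong) (auto, metis)
  finally show ?thesis by (simp add: card_residue_classes)
qed

lemma measure_closed_ball_step:
  assumes "a \<noteq> 0" "b \<noteq> 0" "absK a = q * absK b"
  shows "measure \<mu> (closed_ball (absK a)) = q * measure \<mu> (closed_ball (absK b))"
  using emeasure_closed_ball_step[OF assms]
  by (simp add: measure_def enn2real_mult ennreal_of_nat_eq_real_of_nat)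

text \<open>Starting from the unit ball, each step of the exponent up or down changes the measure by
  the nonzero factor \<open>q\<close> or its inverse. This permits cancelling the measure of a ball
  later.\<close>

lemma measure_closed_ball_nonzero:
  assumes "emeasure \<mu> (closed_ball 1) = 1" "b \<noteq> 0"
  shows "measure \<mu> (closed_ball (absK b)) \<noteq> 0"
proof -
  have "measure \<mu> (closed_ball (q powi N)) \<noteq> 0" for N
  proof (induction N rule: int_induct[where k = 0])
    case base
    then show ?case using assms(1) by (simp add: measure_def)
  next
    case (step1 i)
    obtain a b where "a \<noteq> 0" "absK a = q powi (i + 1)" "b \<noteq> 0" "absK b = q powi i"
      using absK_attains by metis
    then show ?case
      using measure_closed_ball_step[of a b] step1 q_gt_1 by (simp add: power_int_add_1 mult.commute)
  next
    case (step2 i)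
    obtain a b where "a \<noteq> 0" "absK a = q powi i" "b \<noteq> 0" "absK b = q powi (i - 1)"
      using absK_attains by metis
    then show ?case
      using measure_closed_ball_step[of a b] step2 q_gt_1
        power_int_add_1[of q "i - 1"] by (simp add: mult.commute)
  qed
  then show ?thesis using absK_values[OF assms(2)] by auto
qed

text \<open>The sphere is the closed ball minus the open ball of the same radius, and that open ball
  is the closed ball of radius \<open>absK b\<close>. The larger ball has finite measure, so
  measures can be subtracted.\<close>

lemma measure_sphere:
  assumes "a \<noteq> 0" "b \<noteq> 0" "absK a = q * absK b"
  shows "{x. absK x = absK a} = closed_ball (absK a) - closed_ball (absK b)"
    and "{x. absK x = absK a} \<in> sets \<mu>"
    and "emeasure \<mu> {x. absK x = absK a} < \<infinity>"
    and "measure \<mu> {x. absK x = absK a} = (q - 1) * measure \<mu> (closed_ball (absK b))"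
proof -
  have "absK b \<le> absK a" using assms q_gt_1 by simp
  then have sub: "closed_ball (absK b) \<subseteq> closed_ball (absK a)"
    by (fastforce simp: closed_ball_def)
  show eq: "{x. absK x = absK a} = closed_ball (absK a) - closed_ball (absK b)"
    unfolding open_ball_eq_closed_ball[OF assms(2,3), symmetric] by (auto simp: closed_ball_def)
  show "{x. absK x = absK a} \<in> sets \<mu>"
    unfolding eq using closed_ball_in_sets assms(1,2) by blast
  show "emeasure \<mu> {x. absK x = absK a} < \<infinity>"
    unfolding eq
    using emeasure_mono[OF Diff_subset closed_ball_in_sets[OF assms(1)]]
      emeasure_closed_ball_finite[OF assms(1)] by (rule le_less_trans)
  have "measure \<mu> (closed_ball (absK a) - closed_ball (absK b)) =
      measure \<mu> (closed_ball (absK a)) - measure \<mu> (closed_ball (absK b))"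
    using emeasure_closed_ball_finite[OF assms(1)] closed_ball_in_sets sub assms(1,2)
    by (intro measure_Diff) auto
  then show "measure \<mu> {x. absK x = absK a} = (q - 1) * measure \<mu> (closed_ball (absK b))"
    unfolding eq by (simp add: measure_closed_ball_step[OF assms] algebra_simps)
qed

section \<open>Integrals of the radial function and its transform\<close>

context
  fixes \<phi> :: "real \<Rightarrow> complex"
  assumes loc_int: "locally_integrable \<mu> (\<lambda>x. \<phi> (absK x))"
begin

lemma integrable_closed_ball:
  "b \<noteq> 0 \<Longrightarrow> set_integrable \<mu> (closed_ball (absK b)) (\<lambda>x. \<phi> (absK x))"
  using loc_int compact_closed_ball by (simp add: locally_integrable_def)

text \<open>The integrand is constant on the sphere, which has finite measure.\<close>

lemma sphere_integral:
  assumes "a \<noteq> 0" "b \<noteq> 0" "absK a = q * absK b"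
  shows "has_bochner_integral \<mu>
    (\<lambda>x. indicat_real {x. absK x = absK a} x *\<^sub>R \<phi> (absK x))
    (complex_of_real ((q - 1) * measure \<mu> (closed_ball (absK b))) * \<phi> (absK a))"
proof -
  have "has_bochner_integral \<mu> (\<lambda>x. indicat_real {x. absK x = absK a} x *\<^sub>R \<phi> (absK a))
      (measure \<mu> {x. absK x = absK a} *\<^sub>R \<phi> (absK a))"
    using measure_sphere[OF assms] by (intro has_bochner_integral_indicator) auto
  moreover have "(\<lambda>x. indicat_real {x. absK x = absK a} x *\<^sub>R \<phi> (absK a)) =
      (\<lambda>x. indicat_real {x. absK x = absK a} x *\<^sub>R \<phi> (absK x))"
    by (auto simp: fun_eq_iff split: split_indicator)
  ultimately show ?thesis
    using measure_sphere(4)[OF assms] by (simp add: scaleR_conv_of_real)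
qed

lemma ball_integral_step:
  assumes "a \<noteq> 0" "b \<noteq> 0" "absK a = q * absK b"
  shows "(LINT x:closed_ball (absK a)|\<mu>. \<phi> (absK x)) =
    (LINT x:closed_ball (absK b)|\<mu>. \<phi> (absK x)) +
    complex_of_real ((q - 1) * measure \<mu> (closed_ball (absK b))) * \<phi> (absK a)"
proof -
  have "absK b < absK a" using assms q_gt_1 by simp
  then have "(\<lambda>x. indicat_real (closed_ball (absK a)) x *\<^sub>R \<phi> (absK x)) =
      (\<lambda>x. indicat_real (closed_ball (absK b)) x *\<^sub>R \<phi> (absK x) +
        indicat_real {x. absK x = absK a} x *\<^sub>R \<phi> (absK x))"
    unfolding measure_sphere(1)[OF assms] closed_ball_def
    by (auto simp: fun_eq_iff split: split_indicator)
  then show ?thesis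
    using sphere_integral[OF assms] integrable_closed_ball[OF assms(2)]
    unfolding set_lebesgue_integral_def set_integrable_def
    by (simp add: has_bochner_integral_iff)
qed

lemma laplace_type_transform_eq:
  assumes "a \<noteq> 0" "b \<noteq> 0" "absK a = q * absK b"
  shows "laplace_type_transform absK \<mu> \<phi> (1 / b) =
    (LINT x:closed_ball (absK b)|\<mu>. \<phi> (absK x)) -
    complex_of_real (measure \<mu> (closed_ball (absK b))) * \<phi> (absK a)"
proof -
  \<comment> \<open>With \<xi> = \<open>1 / b\<close> the argument of \<open>v0\<close> is
    \<open>absK x / absK b\<close>: it is at most 1 exactly on the ball of radius
    \<open>absK b\<close>, and equals \<open>q\<close> exactly on the sphere of radius
    \<open>absK a\<close>.\<close>
  have "v0 (residue_card absK) (absK (x * (1 / b))) =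
      indicat_real (closed_ball (absK b)) x - indicat_real {x. absK x = absK a} x / (q - 1)" for x
    using assms q_gt_1
    by (auto simp: v0_def absK_divide closed_ball_def indicator_def divide_simps)
  then have integrand: "complex_of_real (v0 (residue_card absK) (absK (x * (1 / b)))) * \<phi> (absK x) =
      indicat_real (closed_ball (absK b)) x *\<^sub>R \<phi> (absK x) -
        complex_of_real (1 / (q - 1)) * (indicat_real {x. absK x = absK a} x *\<^sub>R \<phi> (absK x))" for x
    by (simp only:) (simp add: scaleR_conv_of_real algebra_simps)
  let ?m = "measure \<mu> (closed_ball (absK b))"
  have "has_bochner_integral \<mu> (\<lambda>x. indicat_real (closed_ball (absK b)) x *\<^sub>R \<phi> (absK x))
      (LINT x:closed_ball (absK b)|\<mu>. \<phi> (absK x))"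
    using integrable_closed_ball[OF assms(2)]
    unfolding set_lebesgue_integral_def set_integrable_def by (rule has_bochner_integral_integrable)
  then have "laplace_type_transform absK \<mu> \<phi> (1 / b) = (LINT x:closed_ball (absK b)|\<mu>. \<phi> (absK x)) -
      complex_of_real (1 / (q - 1)) * (complex_of_real ((q - 1) * ?m) * \<phi> (absK a))"
    unfolding laplace_type_transform_def integrand
    by (intro has_bochner_integral_integral_eq has_bochner_integral_diff
        has_bochner_integral_mult_right sphere_integral[OF assms])
  \<comment> \<open>The weight of \<open>v0\<close> on the sphere cancels the factor
    \<open>q - 1\<close> in the measure of the sphere.\<close>
  moreover have "complex_of_real (1 / (q - 1)) * complex_of_real ((q - 1) * ?m) = complex_of_real ?m"
    unfolding of_real_mult[symmetric] using q_gt_1 by simp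
  ultimately show ?thesis by (metis mult.assoc)
qed

lemma radial_profile_step:
  assumes unit: "emeasure \<mu> (closed_ball 1) = 1"
    and zero: "\<And>\<xi>. \<xi> \<noteq> 0 \<Longrightarrow> laplace_type_transform absK \<mu> \<phi> \<xi> = 0"
  shows "\<phi> (q powi (N + 1)) = \<phi> (q powi N)"
proof -
  define I where "I b = (LINT x:closed_ball (absK b)|\<mu>. \<phi> (absK x))" for b
  define m where "m b = complex_of_real (measure \<mu> (closed_ball (absK b)))" for b
  \<comment> \<open>Three consecutive values: with \<open>r = absK c\<close>, \<open>absK b\<close>
    is \<open>q * r\<close> and \<open>absK a\<close> is \<open>q * (q * r)\<close>. The transform
    is evaluated at \<open>1 / b\<close> and \<open>1 / c\<close>.\<close>
  obtain a b c where nz: "a \<noteq> 0" "b \<noteq> 0" "c \<noteq> 0" and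
    abs: "absK a = q powi (N + 1)" "absK b = q powi N" "absK c = q powi (N - 1)"
    using absK_attains by metis
  have ab: "absK a = q * absK b" and bc: "absK b = q * absK c"
    using abs q_gt_1 power_int_add_1[of q N] power_int_add_1[of q "N - 1"]
    by (simp_all add: mult.commute)
  have Ib: "I b = m b * \<phi> (absK a)"
    using laplace_type_transform_eq[OF nz(1,2) ab] zero[of "1 / b"] nz
    by (simp add: I_def m_def)
  have Ic: "I c = m c * \<phi> (absK b)"
    using laplace_type_transform_eq[OF nz(2,3) bc] zero[of "1 / c"] nz
    by (simp add: I_def m_def)
  have "I b = I c + (of_real q - 1) * m c * \<phi> (absK b)"
    using ball_integral_step[OF nz(2,3) bc] by (simp add: I_def m_def)
  also have "\<dots> = of_real q * m c * \<phi> (absK b)"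
    by (simp add: Ic algebra_simps)
  also have "of_real q * m c = m b"
    using measure_closed_ball_step[OF nz(2,3) bc] by (simp add: m_def)
  finally have "m b * \<phi> (absK a) = m b * \<phi> (absK b)"
    using Ib by simp
  moreover have "m b \<noteq> 0"
    using measure_closed_ball_nonzero[OF unit nz(2)] by (simp add: m_def)
  ultimately show ?thesis using abs by simp
qed

end

end

end

theorem theorem4:
  fixes absK :: "'a::nonarch_local_field \<Rightarrow> real"
    and \<mu> :: "'a measure"
    and \<phi> :: "real \<Rightarrow> complex"
  assumes "normalized_absolute_value absK"
    and "haar_measure \<mu>"
    and "emeasure \<mu> {x. absK x \<le> 1} = 1"
    and "locally_integrable \<mu> (\<lambda>x. \<phi> (absK x))"
    and "\<forall>\<xi>. \<xi> \<noteq> 0 \<longrightarrow> laplace_type_transform absK \<mu> \<phi> \<xi> = 0"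
  shows "\<exists>c. \<forall>x. x \<noteq> 0 \<longrightarrow> \<phi> (absK x) = c"
proof -
  interpret normalized_local_field absK
    using assms(1) by unfold_locales
  have step: "\<phi> (q powi (N + 1)) = \<phi> (q powi N)" for N
    using radial_profile_step[OF assms(2,4)] assms(3,5) by (simp add: closed_ball_def)
  have "\<phi> (q powi N) = \<phi> (q powi 0)" for N
  proof (induction N rule: int_induct[where k = 0])
    case (step2 i)
    then show ?case using step[of "i - 1"] by simp
  qed (simp_all add: step)
  \<comment> \<open>Every nonzero \<open>x\<close> has a power of \<open>q\<close> as its absolute
    value, so the common value \<open>\<phi> (q powi 0)\<close> serves as the constant.\<close>
  then show ?thesis using absK_values by metis
qed

end
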